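(* Let $\lambda\in\mathbb{C}_p$ with $\lambda\ne0$ and $|\lambda|_p\le1$ ($p$ an odd prime). For every $n\ge0$, \[ Ch_{n,\lambda}(x+1)+Ch_{n,\lambda}(x)=2\sum_{m=0}^n(x)_{m,\lambda}\,S_1(n,m). \]
   Context: $(x)_{0,\lambda}=1$, $(x)_{n,\lambda}=x(x-\lambda)\cdots(x-(n-1)\lambda)$ for $n\ge1$, and $(1+\lambda u)^{x/\lambda}=\sum_{m\ge0}(x)_{m,\lambda}u^m/m!$. $S_1(n,m)$ are the signed Stirling numbers of the first kind: $x(x-1)\cdots(x-n+1)=\sum_{m=0}^nS_1(n,m)x^m$. The degenerate Changhee polynomials of the second kind: $\frac{2}{1+(1+\lambda\log(1+t))^{1/\lambda}}(1+\lambda\log(1+t))^{x/\lambda}=\sum_{n\ge0}Ch_{n,\lambda}(x)\frac{t^n}{n!}$. *)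

theory Defs
  imports Complex_Main "HOL-Computational_Algebra.Computational_Algebra"
begin

text \<open>
  The libraries contain no p-adic numbers.  We describe \<open>\<complex>\<^sub>p\<close> as a field \<open>'a\<close> with an absolute
  value \<open>v\<close> such that \<open>'a\<close> is the completion of an algebraic closure of the completion of
  \<open>\<rat>\<close> with respect to the p-adic absolute value.  This determines \<open>('a, v)\<close> up to isometric
  isomorphism.  The completion of \<open>\<rat>\<close> and its algebraic closure are realised
  as subfields of \<open>'a\<close>.
\<close>

definition padic_abs :: "nat \<Rightarrow> rat \<Rightarrow> real" where
  "padic_abs p r =
     (if r = 0 then 0
      else real p powi (int (multiplicity (int p) (snd (quotient_of r)))
                      - int (multiplicity (int p) (fst (quotient_of r)))))"

definition val_closure :: "('a::field_char_0 \<Rightarrow> real) \<Rightarrow> 'a set \<Rightarrow> 'a set" where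
  "val_closure v S = {x. \<forall>e>0. \<exists>y\<in>S. v (x - y) < e}"

definition val_complete :: "('a::field_char_0 \<Rightarrow> real) \<Rightarrow> bool" where
  "val_complete v \<longleftrightarrow>
     (\<forall>X :: nat \<Rightarrow> 'a.
        (\<forall>e>0. \<exists>N. \<forall>m\<ge>N. \<forall>n\<ge>N. v (X m - X n) < e) \<longrightarrow>
        (\<exists>x. (\<lambda>n. v (X n - x)) \<longlonglongrightarrow> 0))"

definition algebraic_over :: "'a::field_char_0 set \<Rightarrow> 'a set" where
  "algebraic_over F = {x. \<exists>q. q \<noteq> 0 \<and> (\<forall>i. coeff q i \<in> F) \<and> poly q x = 0}"

definition alg_closed_subfield :: "'a::field_char_0 set \<Rightarrow> bool" where
  "alg_closed_subfield L \<longleftrightarrow>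
     (\<forall>q. degree q > 0 \<and> (\<forall>i. coeff q i \<in> L) \<longrightarrow> (\<exists>x\<in>L. poly q x = 0))"

text \<open>The copies of \<open>\<rat>\<^sub>p\<close> and of its algebraic closure inside \<open>\<complex>\<^sub>p\<close>.\<close>

definition Qp_in :: "('a::field_char_0 \<Rightarrow> real) \<Rightarrow> 'a set" where
  "Qp_in v = val_closure v (range of_rat)"

definition Qp_alg_in :: "('a::field_char_0 \<Rightarrow> real) \<Rightarrow> 'a set" where
  "Qp_alg_in v = algebraic_over (Qp_in v)"

locale padic_complex_field =
  fixes p :: nat and v :: "'a::field_char_0 \<Rightarrow> real"
  assumes prime_p: "prime p"
    and v_nonneg: "v x \<ge> 0"
    and v_eq_0_iff: "v x = 0 \<longleftrightarrow> x = 0"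
    and v_mult: "v (x * y) = v x * v y"
    and v_ultrametric: "v (x + y) \<le> max (v x) (v y)"
    and v_of_rat: "v (of_rat r) = padic_abs p r"
    and complete: "val_complete v"
    and alg_closed: "alg_closed_subfield (Qp_alg_in v)"
    and dense: "val_closure v (Qp_alg_in v) = UNIV"

definition degen_ffact :: "'a::field_char_0 \<Rightarrow> nat \<Rightarrow> 'a \<Rightarrow> 'a" where
  "degen_ffact x n lam = (\<Prod>i<n. x - of_nat i * lam)"

definition Stirling1 :: "nat \<Rightarrow> nat \<Rightarrow> int" where
  "Stirling1 n m = coeff (\<Prod>i<n. [:- int i, 1:]) m"

text \<open>The series \<open>(1 + \<lambda>u)\<^bsup>x/\<lambda>\<^esup>\<close> in \<open>u\<close>.\<close>

definition degen_exp :: "'a::field_char_0 \<Rightarrow> 'a \<Rightarrow> 'a fps" where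
  "degen_exp lam x = Abs_fps (\<lambda>m. degen_ffact x m lam / fact m)"

text \<open>Here \<open>fps_ln 1\<close> is the series \<open>log(1 + t)\<close>. The polynomial is given by its values at
  the points \<open>x\<close> of the field.\<close>

definition changhee2_gf :: "'a::field_char_0 \<Rightarrow> 'a \<Rightarrow> 'a fps" where
  "changhee2_gf lam x =
     (2 / (1 + (degen_exp lam 1 oo fps_ln 1))) * (degen_exp lam x oo fps_ln 1)"

definition changhee2 :: "nat \<Rightarrow> 'a::field_char_0 \<Rightarrow> 'a \<Rightarrow> 'a" where
  "changhee2 n lam x = fact n * fps_nth (changhee2_gf lam x) n"

lemma changhee2_gf_eq:
  "changhee2_gf lam x = Abs_fps (\<lambda>n. changhee2 n lam x / fact n)"
  by (simp add: fps_eq_iff changhee2_def)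

lemma Stirling1_expansion:
  "(\<Prod>i<n. x - of_nat i) = (\<Sum>m\<le>n. of_int (Stirling1 n m) * (x :: 'a::field_char_0) ^ m)"
proof -
  let ?q = "\<lambda>n. \<Prod>i<n. [:- int i, 1:]"
  have d: "degree (?q n) = n"
    by (subst degree_prod_eq_sum_degree) auto
  have step: "map_poly of_int (r * [:- int k, 1:]) = map_poly of_int r * [:- of_nat k, 1 :: 'a:]"
    for r k
    by (intro poly_eqI) (simp add: coeff_map_poly coeff_pCons split: nat.split)
  have "map_poly of_int (?q n) = (\<Prod>i<n. [:- of_nat i, 1 :: 'a:])"
    by (induction n) (simp_all add: step del: mult_pCons_right)
  then have "(\<Prod>i<n. x - of_nat i) = poly (map_poly of_int (?q n)) x"
    by (simp add: poly_prod)
  also have "\<dots> = (\<Sum>m\<le>degree (?q n). of_int (coeff (?q n) m) * x ^ m)"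
    by (simp add: poly_altdef coeff_map_poly degree_map_poly)
  finally show ?thesis by (simp add: d Stirling1_def)
qed

lemma changhee2_is_polynomial:
  "\<exists>q. \<forall>x. changhee2 n lam x = poly q (x :: 'a::field_char_0)"
proof -
  let ?g = "2 / (1 + (degen_exp lam 1 oo fps_ln 1)) :: 'a fps"
  let ?q = "smult (fact n) (\<Sum>i=0..n. smult (fps_nth ?g i)
     (\<Sum>j=0..n - i. smult (fps_nth (fps_ln 1 ^ j) (n - i) / fact j) (\<Prod>k<j. [:- of_nat k * lam, 1:])))"
  have "changhee2 n lam x = poly ?q x" for x
    by (simp add: changhee2_def changhee2_gf_def fps_mult_nth fps_compose_nth degen_exp_def
        degen_ffact_def poly_sum poly_prod mult.commute[of "fps_nth _ _" "prod _ _"])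
  then show ?thesis by blast
qed

end

theory Submission
  imports Defs
begin

text \<open>
  Since \<open>degen_exp lam x\<close> is the binomial series \<open>(1 + \<lambda>u)\<close> to the power \<open>x/\<lambda>\<close>, it turns sums in \<open>x\<close> into
  products, so adding the generating functions at \<open>x + 1\<close> and \<open>x\<close> cancels the denominator
  and leaves \<open>2 (1 + \<lambda> log(1 + t))\<^bsup>x/\<lambda>\<^esup>\<close>.  Its coefficients are read off from
  \<open>log(1 + t)\<^sup>m / m! = \<Sum>\<^sub>n S\<^sub>1(n, m) t\<^sup>n / n!\<close>.
\<close>

lemma degen_exp_eq_binomial:
  assumes "lam \<noteq> 0"
  shows "degen_exp lam x = fps_binomial (x / lam) oo (fps_const lam * fps_X)"
proof -
  have "degen_ffact x m lam = lam ^ m * (\<Prod>i<m. x / lam - of_nat i)" for m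
    unfolding degen_ffact_def using assms
    by (induction m) (simp_all add: field_simps)
  then show ?thesis
    by (simp add: fps_eq_iff fps_compose_linear degen_exp_def gbinomial_prod_rev
        atLeast0LessThan)
qed

lemma degen_exp_add:
  assumes "lam \<noteq> 0"
  shows "degen_exp lam (x + y) = degen_exp lam x * degen_exp lam y"
  by (simp add: degen_exp_eq_binomial[OF assms] add_divide_distrib fps_binomial_add_mult
      fps_compose_mult_distrib)

lemma changhee2_gf_add:
  assumes "lam \<noteq> 0"
  shows "changhee2_gf lam (x + 1) + changhee2_gf lam x = 2 * (degen_exp lam x oo fps_ln 1)"
proof -
  define E where "E = degen_exp lam 1 oo fps_ln 1"
  define F where "F = degen_exp lam x oo fps_ln 1"
  have unit: "fps_nth (1 + E) 0 \<noteq> 0"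
    by (simp add: E_def degen_exp_def degen_ffact_def)
  have "changhee2_gf lam (x + 1) + changhee2_gf lam x = 2 / (1 + E) * (1 + E) * F"
    by (simp add: changhee2_gf_def degen_exp_add[OF assms] E_def F_def
        fps_compose_mult_distrib fps_ln_def algebra_simps)
  also have "2 / (1 + E) * (1 + E) = 2"
    using unit by (simp add: fps_divide_unit mult.assoc inverse_mult_eq_1)
  finally show ?thesis by (simp add: F_def)
qed

lemma Stirling1_0_left: "Stirling1 0 m = (if m = 0 then 1 else 0)"
  by (simp add: Stirling1_def)

lemma Stirling1_Suc_0: "Stirling1 (Suc n) 0 = - int n * Stirling1 n 0"
  by (simp add: Stirling1_def)

lemma Stirling1_Suc_Suc:
  "Stirling1 (Suc n) (Suc m) = Stirling1 n m - int n * Stirling1 n (Suc m)"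
  by (simp add: Stirling1_def)

lemma Stirling1_0_right: "Stirling1 n 0 = (if n = 0 then 1 else 0)"
  by (induction n) (simp_all add: Stirling1_0_left Stirling1_Suc_0)

lemma fps_ln_power_nth_Suc:
  "of_nat (Suc n) * fps_nth (fps_ln 1 ^ Suc m) (Suc n)
     = of_nat (Suc m) * fps_nth (fps_ln 1 ^ m) n
       - of_nat n * fps_nth (fps_ln (1 :: 'a::field_char_0) ^ Suc m) n"
proof -
  let ?L = "fps_ln 1 :: 'a fps"
  have "fps_deriv (?L ^ Suc m) * (1 + fps_X)
      = of_nat (Suc m) * ?L ^ m * (fps_deriv ?L * (1 + fps_X))"
    by (simp add: fps_deriv_power fps_of_nat[symmetric] algebra_simps del: of_nat_Suc power_Suc)
  also have "fps_deriv ?L * (1 + fps_X) = 1"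
    by (simp add: fps_ln_deriv fps_divide_unit inverse_mult_eq_1)
  finally have "fps_nth (fps_deriv (?L ^ Suc m) * (1 + fps_X)) n
      = fps_nth (of_nat (Suc m) * ?L ^ m) n"
    by simp
  then show ?thesis
    by (cases n) (simp_all add: distrib_left fps_of_nat[symmetric] eq_diff_eq del: of_nat_Suc power_Suc)
qed

lemma fps_ln_power_nth:
  "fps_nth (fps_ln 1 ^ m) n = fact m / fact n * (of_int (Stirling1 n m) :: 'a::field_char_0)"
proof (induction n arbitrary: m)
  case 0
  then show ?case
    by (cases m) (simp_all add: Stirling1_0_left fps_ln_def)
next
  case (Suc n)
  show ?case
  proof (cases m)
    case 0
    then show ?thesis by (simp add: Stirling1_0_right)
  next
    case (Suc k)
    have "of_nat (Suc n) * fps_nth (fps_ln 1 ^ Suc k) (Suc n)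
        = of_nat (Suc k) * (fact k / fact n * of_int (Stirling1 n k))
          - of_nat n * (fact (Suc k) / fact n * (of_int (Stirling1 n (Suc k)) :: 'a))"
      by (simp only: fps_ln_power_nth_Suc Suc.IH)
    also have "\<dots> = fact (Suc k) / fact n * of_int (Stirling1 (Suc n) (Suc k))"
      by (simp add: Stirling1_Suc_Suc field_simps)
    also have "\<dots> = of_nat (Suc n) * (fact (Suc k) / fact (Suc n) * of_int (Stirling1 (Suc n) (Suc k)))"
      by (simp add: fact_Suc[of n] del: of_nat_Suc fact_Suc)
    finally show ?thesis
      unfolding Suc by (simp only: mult_cancel_left of_nat_eq_0_iff) simp
  qed
qed

theorem theorem2p7:
  fixes p :: nat and v :: "'a::field_char_0 \<Rightarrow> real" and lam x :: 'a and n :: nat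
  assumes "padic_complex_field p v" and "odd p"
    and "lam \<noteq> 0" and "v lam \<le> 1"
  shows "changhee2 n lam (x + 1) + changhee2 n lam x
           = 2 * (\<Sum>m=0..n. degen_ffact x m lam * of_int (Stirling1 n m))"
proof -
  have "changhee2 n lam (x + 1) + changhee2 n lam x
      = fact n * fps_nth (2 * (degen_exp lam x oo fps_ln 1)) n"
    by (simp add: changhee2_def changhee2_gf_add[OF assms(3), symmetric] distrib_left)
  also have "\<dots> = 2 * (\<Sum>m=0..n. degen_ffact x m lam * of_int (Stirling1 n m))"
    by (simp add: numeral_fps_const fps_compose_nth degen_exp_def
        fps_ln_power_nth sum_distrib_left)
  finally show ?thesis .
qed

end
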